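(* Let $\alpha\in(0,1)$ be an unknown parameter, let $n\ge 1$, and let $Z_1,\dots,Z_n$ be a random sample (i.i.d.) from the probability density function $$f_{Z^{\alpha}}(z)=\frac{\sin(\pi\alpha)}{\pi (z-1)^{\alpha}z}\,1_{z\ge 1}.$$ Then the maximum likelihood estimator of $\alpha$ over the parameter space $(0,1)$ is (almost surely) given by $$\hat{\alpha}_{mle}=\begin{cases}\dfrac{1}{\pi}\arctan\!\left(\dfrac{n\pi}{\ln\left(\prod_{i=1}^{n}(Z_i-1)\right)}\right) & \text{if } 0<\arctan\!\left(\dfrac{n\pi}{\ln\left(\prod_{i=1}^{n}(Z_i-1)\right)}\right)\le \dfrac{\pi}{2},\\[3ex] \dfrac{1}{\pi}\left[\pi+\arctan\!\left(\dfrac{n\pi}{\ln\left(\prod_{i=1}^{n}(Z_i-1)\right)}\right)\right] & \text{if } -\dfrac{\pi}{2}\le\arctan\!\left(\dfrac{n\pi}{\ln\left(\prod_{i=1}^{n}(Z_i-1)\right)}\right)\le 0.\end{cases}$$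
   Context: The density $f_{Z^{\alpha}}$ is the jump-size density of the InG subordinator, which for $\alpha\in(0,1)$ is the compound Poisson process $S_\alpha(t)=\sum_{j=1}^{N_\alpha(t)}Z_j^{\alpha}$, where $N_\alpha$ is a homogeneous Poisson process of rate $\alpha\Gamma(\alpha)$ and the jumps $Z_j^{\alpha}$ are i.i.d. with density $f_{Z^\alpha}$. The likelihood function of a sample $z_1,\dots,z_n$ is $L(\alpha)=\prod_{i=1}^n f_{Z^{\alpha}}(z_i)$, $\alpha\in(0,1)$. The maximum likelihood estimator is the point of global maximum of $L$ over $(0,1)$, evaluated at the random sample. Here $\arctan$ is the principal branch, with the convention $\arctan(\pm\infty)=\pm\pi/2$, so that the estimator equals $1/2$ when $\prod_{i=1}^n (Z_i-1)=1$. "Almost surely" refers to the fact that $Z_i>1$ for all $i$ with probability one. *)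

theory Defs
  imports "HOL-Probability.Probability"
begin

text \<open>Jump-size density. At \<open>z = 1\<close>, where the formula is singular, the value is \<open>0\<close>
  (division by zero).\<close>

definition InG_jump_density :: "real \<Rightarrow> real \<Rightarrow> real" where
  "InG_jump_density \<alpha> z = sin (pi * \<alpha>) / (pi * (z - 1) powr \<alpha> * z) * indicator {1..} z"

definition likelihood :: "nat \<Rightarrow> (nat \<Rightarrow> real) \<Rightarrow> real \<Rightarrow> real" where
  "likelihood n z \<alpha> = (\<Prod>i=1..n. InG_jump_density \<alpha> (z i))"

definition ext_arctan :: "ereal \<Rightarrow> real" where
  "ext_arctan x = (case x of ereal r \<Rightarrow> arctan r | PInfty \<Rightarrow> pi / 2 | MInfty \<Rightarrow> - pi / 2)"

text \<open>The quotient is taken in \<^typ>\<open>ereal\<close>, where a positive number divided by \<open>0\<close> is \<open>\<infinity>\<close>;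
  so the angle is \<open>pi / 2\<close> when the product is \<open>1\<close>.\<close>

definition mle_angle :: "nat \<Rightarrow> (nat \<Rightarrow> real) \<Rightarrow> real" where
  "mle_angle n z = ext_arctan (ereal (real n * pi) / ereal (ln (\<Prod>i=1..n. (z i - 1))))"

text \<open>\<^const>\<open>ext_arctan\<close> takes values in \<open>[- pi / 2, pi / 2]\<close>, so the second branch is the case
  \<open>- pi / 2 \<le> mle_angle n z \<le> 0\<close>.\<close>

definition alpha_mle :: "nat \<Rightarrow> (nat \<Rightarrow> real) \<Rightarrow> real" where
  "alpha_mle n z =
     (if 0 < mle_angle n z \<and> mle_angle n z \<le> pi / 2
      then 1 / pi * mle_angle n z
      else 1 / pi * (pi + mle_angle n z))"

end

theory Submission
  imports Defs
begin

text \<open>When every \<open>z i\<close> exceeds \<open>1\<close>, the likelihood at \<open>\<theta> / pi\<close> is, up to a positive constant, the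
  \<open>n\<close>-th power of \<open>sin \<theta> * exp (- c * \<theta>)\<close> with \<open>c = ln (\<Prod>i=1..n. (z i - 1)) / (n * pi)\<close>. Since \<open>ln \<circ> sin\<close> is
  strictly concave on \<open>(0, pi)\<close> with derivative \<open>cot\<close>, the unique maximiser is the angle whose
  cotangent is \<open>c\<close>; the two branches of the estimator select this angle in \<open>(0, pi)\<close>.\<close>

text \<open>The difference of \<open>ln (sin x)\<close> and its tangent slope
  \<open>cot u * x\<close> rises before \<open>u\<close> and falls after it, so \<open>u\<close> is
  its strict maximum on the interval.\<close>

lemma ln_sin_less_tangent:
  fixes t u :: real
  assumes t: "0 < t" "t < pi" and u: "0 < u" "u < pi" and "t \<noteq> u"
  shows "ln (sin t) < ln (sin u) + cot u * (t - u)"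
proof -
  let ?f = "\<lambda>x. ln (sin x) - cot u * x"
  \<comment> \<open>This is \<open>cot x - cot u\<close> over a common denominator: since
    \<open>sin x * sin u\<close> is positive, its sign is that of
    \<open>sin (u - x)\<close>.\<close>
  have der: "(?f has_real_derivative sin (u - x) / (sin x * sin u)) (at x)"
    if "0 < x" "x < pi" for x
  proof -
    have "sin x > 0" "sin u > 0"
      using that u by (auto intro: sin_gt_zero)
    then show ?thesis
      by (auto intro!: derivative_eq_intros simp: cot_def sin_diff field_simps)
  qed
  have neg: "(t - u) * (sin (u - x) / (sin x * sin u)) < 0"
    if "0 < x" "x < pi" "t < x \<and> x < u \<or> u < x \<and> x < t" for x
  proof -
    have pos: "sin x * sin u > 0"
      using that u by (intro mult_pos_pos sin_gt_zero)
    show ?thesis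
    proof (cases "t < x \<and> x < u")
      case True
      then have "sin (u - x) > 0"
        using that u by (intro sin_gt_zero) auto
      then show ?thesis
        using True pos by (intro mult_neg_pos divide_pos_pos) auto
    next
      case False
      then have "sin (x - u) > 0"
        using that u t by (intro sin_gt_zero) auto
      then have "sin (u - x) < 0"
        using sin_minus[of "u - x"] by simp
      then show ?thesis
        using False that pos by (intro mult_pos_neg divide_neg_pos) auto
    qed
  qed
  \<comment> \<open>The mean value theorem, put in one form for both orders of \<open>t\<close> and
    \<open>u\<close> so that \<open>neg\<close> settles them together.\<close>
  have "\<exists>x>0. x < pi \<and> (t < x \<and> x < u \<or> u < x \<and> x < t)
    \<and> ?f t - ?f u = (t - u) * (sin (u - x) / (sin x * sin u))"
  proof (cases "t < u")
    case True
    then obtain x where "t < x" "x < u"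
      and "?f u - ?f t = (u - t) * (sin (u - x) / (sin x * sin u))"
      using MVT2[of t u ?f "\<lambda>x. sin (u - x) / (sin x * sin u)"] der t u by force
    then show ?thesis
      using t u by (intro exI[of _ x]) (auto simp: algebra_simps diff_divide_distrib)
  next
    case False
    then have "u < t"
      using \<open>t \<noteq> u\<close> by simp
    then obtain x where "u < x" "x < t"
      and "?f t - ?f u = (t - u) * (sin (u - x) / (sin x * sin u))"
      using MVT2[of u t ?f "\<lambda>x. sin (u - x) / (sin x * sin u)"] der t u by force
    then show ?thesis
      using t u by (intro exI[of _ x]) auto
  qed
  then have "?f t - ?f u < 0"
    using neg by metis
  then show ?thesis
    by (simp add: algebra_simps)
qed

text \<open>All factors are positive, so the logarithm splits. The last sum is free of
  \<open>b\<close> and cancels when two parameters are compared.\<close>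

lemma ln_likelihood:
  assumes z: "\<And>i. i \<in> {1..n} \<Longrightarrow> z i > 1" and b: "0 < b" "b < 1"
  shows "likelihood n z b > 0"
    and "ln (likelihood n z b) =
      real n * ln (sin (pi * b)) - b * ln (\<Prod>i=1..n. (z i - 1)) - (\<Sum>i=1..n. ln (pi * z i))"
proof -
  have s: "sin (pi * b) > 0"
    using b by (intro sin_gt_zero) auto
  have pos: "InG_jump_density b (z i) > 0"
    and ln_eq: "ln (InG_jump_density b (z i)) = ln (sin (pi * b)) - b * ln (z i - 1) - ln (pi * z i)"
    if "i \<in> {1..n}" for i
    using z[OF that] s
    by (auto simp: InG_jump_density_def ln_div ln_mult ln_powr intro!: divide_pos_pos mult_pos_pos)
  show "likelihood n z b > 0"
    unfolding likelihood_def using pos by (intro prod_pos) auto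
  have "ln (likelihood n z b) = (\<Sum>i=1..n. ln (InG_jump_density b (z i)))"
    unfolding likelihood_def using pos by (intro ln_prod) force+
  also have "\<dots> = (\<Sum>i=1..n. ln (sin (pi * b)) - b * ln (z i - 1) - ln (pi * z i))"
    using ln_eq by (intro sum.cong) auto
  also have "\<dots> = real n * ln (sin (pi * b)) - b * (\<Sum>i=1..n. ln (z i - 1)) - (\<Sum>i=1..n. ln (pi * z i))"
    by (simp add: sum_subtractf sum_distrib_left)
  also have "(\<Sum>i=1..n. ln (z i - 1)) = ln (\<Prod>i=1..n. (z i - 1))"
    using z by (intro ln_prod[symmetric]) force+
  finally show "ln (likelihood n z b) =
      real n * ln (sin (pi * b)) - b * ln (\<Prod>i=1..n. (z i - 1)) - (\<Sum>i=1..n. ln (pi * z i))" .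
qed

text \<open>Replaces the two-branch formula by the stationarity condition of the log-likelihood, the
  only form used later.\<close>

lemma alpha_mle_cot:
  assumes "n \<ge> 1"
  shows "0 < alpha_mle n z" "alpha_mle n z < 1"
    and "cot (pi * alpha_mle n z) = ln (\<Prod>i=1..n. (z i - 1)) / (real n * pi)"
proof -
  define S where "S = ln (\<Prod>i=1..n. (z i - 1))"
  have np: "real n * pi > 0"
    using assms by simp
  have "0 < alpha_mle n z \<and> alpha_mle n z < 1 \<and> cot (pi * alpha_mle n z) = S / (real n * pi)"
  proof (cases "S = 0")
    case True
    \<comment> \<open>The extended quotient is infinite here; real division by zero would give angle
      \<open>0\<close> and the estimate \<open>1\<close>, outside the parameter space.\<close>
    then have "mle_angle n z = pi / 2"
      using assms unfolding mle_angle_def S_def[symmetric]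
      by (simp add: ext_arctan_def divide_ereal_def zero_ereal_def[symmetric])
    then have "alpha_mle n z = 1 / 2"
      by (simp only: alpha_mle_def) simp
    show ?thesis
      unfolding \<open>alpha_mle n z = 1 / 2\<close> using True by (simp add: cot_def)
  next
    case False
    define r where "r = real n * pi / S"
    have angle: "mle_angle n z = arctan r"
      using False unfolding mle_angle_def S_def[symmetric] r_def
      by (simp add: ext_arctan_def)
    have bounds: "- (pi / 2) < arctan r" "arctan r < pi / 2"
      by (rule arctan_lbound, rule arctan_ubound)
    have cot_arctan: "cot (arctan r) = S / (real n * pi)"
      using tan_arctan[of r] by (simp add: cot_altdef r_def)
    show ?thesis
    proof (cases "S > 0")
      case True
      then have "arctan r > 0"
        using np by (simp add: r_def)
      then show ?thesis
        using bounds cot_arctan by (auto simp: alpha_mle_def angle field_simps)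
    next
      case S: False
      then have neg: "arctan r < 0"
        using np False by (simp add: r_def divide_pos_neg)
      then have a: "alpha_mle n z = (pi + arctan r) / pi"
        by (simp add: alpha_mle_def angle)
      \<comment> \<open>\<open>cot\<close> has period \<open>pi\<close>, so the second branch moves
        a negative angle into \<open>(pi / 2, pi)\<close> and keeps its cotangent.\<close>
      have "cot (pi * alpha_mle n z) = cot (arctan r)"
        by (simp add: a cot_def)
      moreover have "0 < (pi + arctan r) / pi" "(pi + arctan r) / pi < 1"
        using neg bounds by simp_all
      ultimately show ?thesis
        unfolding cot_arctan a[symmetric] by blast
    qed
  qed
  then show "0 < alpha_mle n z" "alpha_mle n z < 1"
    and "cot (pi * alpha_mle n z) = ln (\<Prod>i=1..n. (z i - 1)) / (real n * pi)"
    by (simp_all add: S_def)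
qed

text \<open>The tangent inequality at the angle \<open>pi * alpha_mle n z\<close>, scaled by
  \<open>n\<close>, compares the log-likelihoods.\<close>

lemma likelihood_less_alpha_mle:
  assumes n: "n \<ge> 1" and z: "\<And>i. i \<in> {1..n} \<Longrightarrow> z i > 1"
    and b: "0 < b" "b < 1" "b \<noteq> alpha_mle n z"
  shows "likelihood n z b < likelihood n z (alpha_mle n z)"
proof -
  define a where "a = alpha_mle n z"
  note a = alpha_mle_cot[OF n, of z, folded a_def]
  define S where "S = ln (\<Prod>i=1..n. (z i - 1))"
  have "ln (sin (pi * b)) < ln (sin (pi * a)) + cot (pi * a) * (pi * b - pi * a)"
    using a b by (intro ln_sin_less_tangent) (auto simp: a_def)
  then have "real n * ln (sin (pi * b))
      < real n * (ln (sin (pi * a)) + S / (real n * pi) * (pi * b - pi * a))"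
    using n by (simp add: a(3) S_def)
  \<comment> \<open>The value of the cotangent turns the tangent term into exactly the change in the
    part of the log-likelihood linear in the parameter.\<close>
  also have "\<dots> = real n * ln (sin (pi * a)) + (b - a) * S"
    using n by (simp add: field_simps)
  finally have "ln (likelihood n z b) < ln (likelihood n z a)"
    using ln_likelihood(2)[of n z, OF z b(1,2)] ln_likelihood(2)[of n z, OF z a(1,2)]
    by (simp add: S_def algebra_simps)
  then show ?thesis
    using ln_likelihood(1)[of n z, OF z b(1,2)] ln_likelihood(1)[of n z, OF z a(1,2)]
    by (simp add: a_def)
qed

lemma is_arg_max_unique:
  fixes f :: "'a \<Rightarrow> 'b::order"
  assumes "P m" and "\<And>x. P x \<Longrightarrow> x \<noteq> m \<Longrightarrow> f x < f m"
  shows "is_arg_max f P a \<longleftrightarrow> a = m"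
  using assms by (force simp: is_arg_max_def)

text \<open>The density is positive only beyond \<open>1\<close>: the indicator kills smaller
  values, and at \<open>1\<close> itself \<open>0 powr \<alpha> = 0\<close> makes the quotient
  \<open>0\<close>.\<close>

lemma (in prob_space) AE_InG_jump_gt_1:
  assumes "distributed M lborel X (\<lambda>z. ennreal (InG_jump_density \<alpha> z))"
  shows "AE \<omega> in M. X \<omega> > 1"
proof -
  have "z > 1" if "0 < ennreal (InG_jump_density \<alpha> z)" for z
    using that by (cases "z = 1") (auto simp: InG_jump_density_def split: split_indicator_asm)
  then have "AE z in distr M lborel X. z > 1"
    using assms
    by (subst distributed_distr_eq_density[OF assms], subst AE_density)
      (auto simp: distributed_borel_measurable)
  then show ?thesis
    by (rule AE_distrD[OF distributed_measurable[OF assms]])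
qed

theorem theorem3p1:
  fixes M :: "'w measure" and Z :: "nat \<Rightarrow> 'w \<Rightarrow> real" and \<alpha> :: real and n :: nat
  assumes "prob_space M"
    and "0 < \<alpha>" and "\<alpha> < 1"
    and "n \<ge> 1"
    and "prob_space.indep_vars M (\<lambda>_. borel) Z {1..n}"
    and "\<And>i. i \<in> {1..n} \<Longrightarrow> distributed M lborel (Z i) (\<lambda>z. ennreal (InG_jump_density \<alpha> z))"
  shows "AE \<omega> in M. \<forall>a. is_arg_max (likelihood n (\<lambda>i. Z i \<omega>)) (\<lambda>b. b \<in> {0<..<1}) a
                        \<longleftrightarrow> a = alpha_mle n (\<lambda>i. Z i \<omega>)"
proof -
  interpret prob_space M
    by fact
  \<comment> \<open>Finitely many null sets are discarded; at each remaining \<open>\<omega>\<close>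
    the claim is deterministic.\<close>
  have "AE \<omega> in M. \<forall>i\<in>{1..n}. Z i \<omega> > 1"
    using assms(6) by (intro AE_finite_allI AE_InG_jump_gt_1) auto
  then show ?thesis
  proof eventually_elim
    case (elim \<omega>)
    then show ?case
      using alpha_mle_cot(1,2)[OF \<open>n \<ge> 1\<close>] likelihood_less_alpha_mle[OF \<open>n \<ge> 1\<close>]
      by (intro allI is_arg_max_unique) auto
  qed
qed

end
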